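(* The function $C^\ast(K)=1/(1+\sqrt K)$ of the degree is constant on each stratum $\mathsf{SDS}_K$ and defines a functor $$F:\mathsf{SDS}\longrightarrow\mathbb R_{>0}^{\mathrm{disc}},\qquad F(\mathcal E)=C^\ast(\deg\mathcal E),\qquad F(\phi)=\mathrm{id}_{C^\ast}$$ from the category of weighted dual skeletons to the discrete category on the set of positive real numbers.
   Context: A weighted dual skeleton is a triple $\mathcal E=(Z,\sigma,\kappa)$ where $Z$ is a non-empty finite set, $\sigma:Z\to Z$ satisfies $\sigma^2=\mathrm{id}$, and $\kappa:Z\to\mathbb R_{>0}$ satisfies $\kappa(z)\kappa(\sigma(z))=K$ for all $z\in Z$, with $K>0$ constant; $K=\deg(\mathcal E)$ is the degree. A morphism $\phi:(Z_1,\sigma_1,\kappa_1)\to(Z_2,\sigma_2,\kappa_2)$ is a map $\phi:Z_1\to Z_2$ with $\phi(\sigma_1(z))=\sigma_2(\phi(z))$ and $\kappa_1(z)=\kappa_2(\phi(z))$ for all $z\in Z_1$. With composition and identities of maps this gives the category $\mathsf{SDS}$; $\mathsf{SDS}_K$ is the full subcategory of skeletons of degree $K$. The discrete category $\mathbb R_{>0}^{\mathrm{disc}}$ has the positive reals as objects and only identity morphisms. *)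

theory Defs
  imports Complex_Main "HOL-Library.FuncSet"
begin

(* Composition and identities carry their objects as arguments, so hom-sets of different
   pairs of objects need not be disjoint.  Comp C X Y W g f is "g after f" for
   f : X -> Y and g : Y -> W. *)

record ('o, 'm) cat =
  Obj :: "'o set"
  Hom :: "'o \<Rightarrow> 'o \<Rightarrow> 'm set"
  Ident :: "'o \<Rightarrow> 'm"
  Comp :: "'o \<Rightarrow> 'o \<Rightarrow> 'o \<Rightarrow> 'm \<Rightarrow> 'm \<Rightarrow> 'm"

locale category =
  fixes C :: "('o, 'm) cat"
  assumes ident_in_hom: "X \<in> Obj C \<Longrightarrow> Ident C X \<in> Hom C X X"
    and comp_in_hom:
      "\<lbrakk>X \<in> Obj C; Y \<in> Obj C; W \<in> Obj C; f \<in> Hom C X Y; g \<in> Hom C Y W\<rbrakk>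
        \<Longrightarrow> Comp C X Y W g f \<in> Hom C X W"
    and comp_ident_right:
      "\<lbrakk>X \<in> Obj C; Y \<in> Obj C; f \<in> Hom C X Y\<rbrakk> \<Longrightarrow> Comp C X X Y f (Ident C X) = f"
    and comp_ident_left:
      "\<lbrakk>X \<in> Obj C; Y \<in> Obj C; f \<in> Hom C X Y\<rbrakk> \<Longrightarrow> Comp C X Y Y (Ident C Y) f = f"
    and comp_assoc:
      "\<lbrakk>V \<in> Obj C; X \<in> Obj C; Y \<in> Obj C; W \<in> Obj C;
        f \<in> Hom C V X; g \<in> Hom C X Y; h \<in> Hom C Y W\<rbrakk>
        \<Longrightarrow> Comp C V X W (Comp C X Y W h g) f = Comp C V Y W h (Comp C V X Y g f)"

locale category_functor = source: category C + target: category D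
  for C :: "('o1, 'm1) cat" and D :: "('o2, 'm2) cat" +
  fixes Fo :: "'o1 \<Rightarrow> 'o2"
    and Fm :: "'o1 \<Rightarrow> 'o1 \<Rightarrow> 'm1 \<Rightarrow> 'm2"
  assumes map_obj: "X \<in> Obj C \<Longrightarrow> Fo X \<in> Obj D"
    and map_hom:
      "\<lbrakk>X \<in> Obj C; Y \<in> Obj C; f \<in> Hom C X Y\<rbrakk> \<Longrightarrow> Fm X Y f \<in> Hom D (Fo X) (Fo Y)"
    and map_ident: "X \<in> Obj C \<Longrightarrow> Fm X X (Ident C X) = Ident D (Fo X)"
    and map_comp:
      "\<lbrakk>X \<in> Obj C; Y \<in> Obj C; W \<in> Obj C; f \<in> Hom C X Y; g \<in> Hom C Y W\<rbrakk>
        \<Longrightarrow> Fm X W (Comp C X Y W g f) = Comp D (Fo X) (Fo Y) (Fo W) (Fm Y W g) (Fm X Y f)"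

definition full_subcategory :: "('o, 'm) cat \<Rightarrow> 'o set \<Rightarrow> ('o, 'm) cat" where
  "full_subcategory C S = C\<lparr>Obj := Obj C \<inter> S\<rparr>"

(* The identity of x, the only morphism with source x, is represented by x itself. *)

definition discrete_category :: "'o set \<Rightarrow> ('o, 'o) cat" where
  "discrete_category S =
    \<lparr>Obj = S,
     Hom = (\<lambda>x y. if x = y then {x} else {}),
     Ident = (\<lambda>x. x),
     Comp = (\<lambda>x y w g f. x)\<rparr>"

record 'a skeleton =
  points :: "'a set"
  dual :: "'a \<Rightarrow> 'a"
  weight :: "'a \<Rightarrow> real"

(* The maps are extensional functions, i.e. undefined off the point set, so that
   equality in HOL is equality of maps defined on the point set. *)

definition weighted_dual_skeleton :: "'a skeleton \<Rightarrow> bool" where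
  "weighted_dual_skeleton E \<longleftrightarrow>
    finite (points E) \<and> points E \<noteq> {} \<and>
    dual E \<in> points E \<rightarrow>\<^sub>E points E \<and>
    (\<forall>z\<in>points E. dual E (dual E z) = z) \<and>
    weight E \<in> points E \<rightarrow>\<^sub>E {0<..} \<and>
    (\<exists>K>0. \<forall>z\<in>points E. weight E z * weight E (dual E z) = K)"

definition deg :: "'a skeleton \<Rightarrow> real" where
  "deg E = (THE K. \<forall>z\<in>points E. weight E z * weight E (dual E z) = K)"

definition skeleton_morphisms :: "'a skeleton \<Rightarrow> 'a skeleton \<Rightarrow> ('a \<Rightarrow> 'a) set" where
  "skeleton_morphisms E1 E2 =
    {\<phi> \<in> points E1 \<rightarrow>\<^sub>E points E2.
      \<forall>z\<in>points E1. \<phi> (dual E1 z) = dual E2 (\<phi> z) \<and> weight E1 z = weight E2 (\<phi> z)}"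

(* The type 'a is the universe from which the point sets are drawn. *)

definition SDS :: "('a skeleton, 'a \<Rightarrow> 'a) cat" where
  "SDS =
    \<lparr>Obj = {E. weighted_dual_skeleton E},
     Hom = skeleton_morphisms,
     Ident = (\<lambda>E. restrict id (points E)),
     Comp = (\<lambda>E1 E2 E3 \<psi> \<phi>. compose (points E1) \<psi> \<phi>)\<rparr>"

definition SDS_stratum :: "real \<Rightarrow> ('a skeleton, 'a \<Rightarrow> 'a) cat" where
  "SDS_stratum K = full_subcategory SDS {E. deg E = K}"

definition pos_reals_disc :: "(real, real) cat" where
  "pos_reals_disc = discrete_category {0<..}"

definition Cstar :: "real \<Rightarrow> real" where
  "Cstar K = 1 / (1 + sqrt K)"

end

theory Submission
  imports Defs
begin

text \<open>
  A morphism commutes with the involutions and preserves weights, so it carries a pair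
  \<open>(z, dual z)\<close> to a pair with the same product of weights. Since a skeleton is non-empty, one such
  pair already determines the degree; hence the existence of a morphism forces source and target to
  have equal degree (lemma \<open>deg_eq_if_morphism\<close>). Thus every function of the degree, applied to
  both ends of a morphism, gives the same value, and the identity at that value is a legitimate
  image of the morphism; functoriality then holds because a discrete category has only identities.
  What is special about \<open>Cstar\<close> is only that it takes positive values at positive degrees.
\<close>

lemma deg_eqI:
  assumes "points E \<noteq> {}"
    and "\<And>z. z \<in> points E \<Longrightarrow> weight E z * weight E (dual E z) = K"
  shows "deg E = K"
  unfolding deg_def using assms by (intro the_equality) auto

lemma weight_mult_dual_eq_deg:
  assumes "weighted_dual_skeleton E" "z \<in> points E"
  shows "weight E z * weight E (dual E z) = deg E"
proof -
  from assms(1) obtain K where K: "\<forall>z\<in>points E. weight E z * weight E (dual E z) = K"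
    and "points E \<noteq> {}"
    unfolding weighted_dual_skeleton_def by blast
  then have "deg E = K" by (intro deg_eqI) auto
  with K assms(2) show ?thesis by simp
qed

lemma deg_pos:
  assumes "weighted_dual_skeleton E"
  shows "deg E > 0"
proof -
  from assms obtain K where "K > 0" "\<forall>z\<in>points E. weight E z * weight E (dual E z) = K"
    and "points E \<noteq> {}"
    unfolding weighted_dual_skeleton_def by blast
  then show ?thesis using deg_eqI[of E K] by auto
qed

lemma Cstar_pos: "K > 0 \<Longrightarrow> Cstar K > 0"
  unfolding Cstar_def by (simp add: add_pos_pos)

text \<open>
  The degree of either skeleton can be read off at a single point: a point of the source and
  its image have the same weight, and so do their duals.
\<close>

lemma deg_eq_if_morphism:
  assumes E1: "weighted_dual_skeleton E1" and E2: "weighted_dual_skeleton E2"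
    and \<phi>: "\<phi> \<in> skeleton_morphisms E1 E2"
  shows "deg E1 = deg E2"
proof -
  obtain z where z: "z \<in> points E1"
    using E1 unfolding weighted_dual_skeleton_def by blast
  have dz: "dual E1 z \<in> points E1"
    using E1 z unfolding weighted_dual_skeleton_def by blast
  have \<phi>z: "\<phi> z \<in> points E2"
    using \<phi> z unfolding skeleton_morphisms_def by blast
  have "deg E1 = weight E1 z * weight E1 (dual E1 z)"
    using weight_mult_dual_eq_deg[OF E1 z] by simp
  also have "\<dots> = weight E2 (\<phi> z) * weight E2 (dual E2 (\<phi> z))"
    using \<phi> z dz unfolding skeleton_morphisms_def by simp
  also have "\<dots> = deg E2"
    by (rule weight_mult_dual_eq_deg[OF E2 \<phi>z])
  finally show ?thesis .
qed

lemma category_discrete: "category (discrete_category S)"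
  by unfold_locales (auto simp: discrete_category_def split: if_splits)

lemma skeleton_morphisms_ident:
  assumes "weighted_dual_skeleton E"
  shows "restrict id (points E) \<in> skeleton_morphisms E E"
proof -
  have "dual E z \<in> points E" if "z \<in> points E" for z
    using assms that unfolding weighted_dual_skeleton_def by blast
  then show ?thesis
    unfolding skeleton_morphisms_def by simp
qed

lemma skeleton_morphisms_compose:
  assumes "weighted_dual_skeleton E1"
    and "\<phi> \<in> skeleton_morphisms E1 E2" "\<psi> \<in> skeleton_morphisms E2 E3"
  shows "compose (points E1) \<psi> \<phi> \<in> skeleton_morphisms E1 E3"
proof -
  have "dual E1 z \<in> points E1" if "z \<in> points E1" for z
    using assms(1) that unfolding weighted_dual_skeleton_def by blast
  moreover have "\<phi> z \<in> points E2" if "z \<in> points E1" for z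
    using assms(2) that unfolding skeleton_morphisms_def by blast
  moreover have "\<psi> z \<in> points E3" if "z \<in> points E2" for z
    using assms(3) that unfolding skeleton_morphisms_def by blast
  ultimately show ?thesis
    using assms(2,3) unfolding skeleton_morphisms_def by (simp add: compose_def)
qed

text \<open>
  The unit laws hold as equalities of HOL functions because morphisms are extensional, so that
  restricting one to the points of its source does not change it.
\<close>

lemma category_SDS: "category (SDS :: ('a skeleton, 'a \<Rightarrow> 'a) cat)"
proof
  fix E :: "'a skeleton"
  assume "E \<in> Obj SDS"
  then show "Ident SDS E \<in> Hom SDS E E"
    by (simp add: SDS_def skeleton_morphisms_ident)
next
  fix E1 E2 E3 :: "'a skeleton" and \<phi> \<psi> :: "'a \<Rightarrow> 'a"
  assume "E1 \<in> Obj SDS" "\<phi> \<in> Hom SDS E1 E2" "\<psi> \<in> Hom SDS E2 E3"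
  then show "Comp SDS E1 E2 E3 \<psi> \<phi> \<in> Hom SDS E1 E3"
    by (simp add: SDS_def skeleton_morphisms_compose)
next
  fix E1 E2 :: "'a skeleton" and \<phi> :: "'a \<Rightarrow> 'a"
  assume "\<phi> \<in> Hom SDS E1 E2"
  then have \<phi>: "\<phi> \<in> points E1 \<rightarrow>\<^sub>E points E2"
    by (simp add: SDS_def skeleton_morphisms_def)
  have outside: "\<phi> z = undefined" if "z \<notin> points E1" for z
    using \<phi> that by (rule PiE_arb)
  have inside: "\<phi> z \<in> points E2" if "z \<in> points E1" for z
    using \<phi> that by (rule PiE_mem)
  show "Comp SDS E1 E1 E2 \<phi> (Ident SDS E1) = \<phi>"
    by (simp add: SDS_def compose_def fun_eq_iff outside)
  show "Comp SDS E1 E2 E2 (Ident SDS E2) \<phi> = \<phi>"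
    by (simp add: SDS_def compose_def fun_eq_iff outside inside)
next
  fix E1 E2 E3 E4 :: "'a skeleton" and \<phi> \<psi> \<chi> :: "'a \<Rightarrow> 'a"
  assume "\<phi> \<in> Hom SDS E1 E2"
  then have "\<phi> z \<in> points E2" if "z \<in> points E1" for z
    using that by (auto simp: SDS_def skeleton_morphisms_def)
  then show "Comp SDS E1 E2 E4 (Comp SDS E2 E3 E4 \<chi> \<psi>) \<phi> =
      Comp SDS E1 E3 E4 \<chi> (Comp SDS E1 E2 E3 \<psi> \<phi>)"
    by (simp add: SDS_def compose_def fun_eq_iff)
qed

theorem mainTheorem10:
  "(\<forall>K>0. \<forall>E \<in> Obj (SDS_stratum K :: ('a skeleton, 'a \<Rightarrow> 'a) cat). Cstar (deg E) = Cstar K) \<and>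
   category_functor (SDS :: ('a skeleton, 'a \<Rightarrow> 'a) cat) pos_reals_disc
     (\<lambda>E. Cstar (deg E))
     (\<lambda>E1 E2 \<phi>. Ident pos_reals_disc (Cstar (deg E1)))"
proof
  show "\<forall>K>0. \<forall>E \<in> Obj (SDS_stratum K :: ('a skeleton, 'a \<Rightarrow> 'a) cat). Cstar (deg E) = Cstar K"
    by (simp add: SDS_stratum_def full_subcategory_def)
next
  interpret source: category "SDS :: ('a skeleton, 'a \<Rightarrow> 'a) cat"
    by (rule category_SDS)
  interpret target: category pos_reals_disc
    unfolding pos_reals_disc_def by (rule category_discrete)
  show "category_functor (SDS :: ('a skeleton, 'a \<Rightarrow> 'a) cat) pos_reals_disc
     (\<lambda>E. Cstar (deg E))
     (\<lambda>E1 E2 \<phi>. Ident pos_reals_disc (Cstar (deg E1)))"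
  proof
    fix E :: "'a skeleton"
    assume "E \<in> Obj SDS"
    then show "Cstar (deg E) \<in> Obj pos_reals_disc"
      by (simp add: SDS_def pos_reals_disc_def discrete_category_def Cstar_pos deg_pos)
  next
    fix E1 E2 :: "'a skeleton" and \<phi> :: "'a \<Rightarrow> 'a"
    assume "E1 \<in> Obj SDS" "E2 \<in> Obj SDS" "\<phi> \<in> Hom SDS E1 E2"
    then have "deg E1 = deg E2"
      by (intro deg_eq_if_morphism) (auto simp: SDS_def)
    then show "Ident pos_reals_disc (Cstar (deg E1))
        \<in> Hom pos_reals_disc (Cstar (deg E1)) (Cstar (deg E2))"
      by (simp add: pos_reals_disc_def discrete_category_def)
  qed (simp_all add: pos_reals_disc_def discrete_category_def)
qed

end
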